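(* Let $n\ge 2$ and $c\in[0,1]$. Consider $n$ agents whose opinions and stubbornness evolve according to the concatenated Friedkin-Johnsen model with median-voter stubbornness update (defined in the context), with weight matrix $W=\frac1n\mathbf{1}_n\mathbf{1}_n^\top$, arbitrary initial opinions $y(0,0)\in[0,1]^n$, and initial stubbornness $\theta_i(0)\in[0,1)$ for all $i=1,\ldots,n$, with $\theta_i(0)>0$ for at least one $i$. Let $$\theta_{\max}=\max_i \theta_i(0),\qquad d(0)=\max_{i,j}|y_i(0,0)-y_j(0,0)|.$$ If $$c\,d(0)+\theta_{\max}<1,$$ then the opinions converge to consensus, i.e. $\lim_{s\to\infty} y(s,\infty)$ exists and lies in $\mathrm{span}\{\mathbf{1}_n\}$.
   Context: Concatenated Friedkin-Johnsen model with median-voter stubbornness update: $n$ agents discuss a sequence of issues $s=0,1,2,\ldots$. Let $y(s,t)\in[0,1]^n$ be the vector of opinions on issue $s$ at time $t=0,1,2,\ldots$, and let $\Theta(s)=\mathrm{diag}(\theta_1(s),\ldots,\theta_n(s))$ collect the agents' stubbornness during issue $s$. For a row-stochastic matrix $W$, the opinions evolve within issue $s$ by $$y(s,t+1)=(I-\Theta(s))\,W\,y(s,t)+\Theta(s)\,y(s,0),$$ and between issues by $y(s+1,0)=y(s,\infty)$, where $y(s,\infty):=\lim_{t\to\infty}y(s,t)$. (Under the stated assumptions this limit exists and equals $(I-(I-\Theta(s))W)^{-1}\Theta(s)\,y(s,0)$.) Stubbornness is updated between issues by $$\theta_i(s+1)=\theta_i(s)+c\,(1-\theta_i(s))\,\delta_i(s+1),\qquad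 \delta_i(s+1)=|y_i(s,\infty)-\mu(y(s,\infty))|,$$ where $\mu(y)$ denotes the median of the entries of $y\in\mathbb{R}^n$ (for even $n$, the average of the two middle values). $\mathbf{1}_n$ is the all-ones vector in $\mathbb{R}^n$. *)

theory Defs
  imports "HOL-Analysis.Analysis" "HOL-Library.Multiset"
begin

definition diag :: "real ^ 'n \<Rightarrow> real ^ 'n ^ 'n" where
  "diag v = (\<chi> i j. if i = j then v $ i else 0)"

definition row_stochastic :: "real ^ 'n ^ 'n \<Rightarrow> bool" where
  "row_stochastic W \<longleftrightarrow> (\<forall>i j. 0 \<le> W $ i $ j) \<and> (\<forall>i. (\<Sum>j\<in>UNIV. W $ i $ j) = 1)"

text \<open>The entries are sorted with multiplicity; list positions count from 0.\<close>

definition sorted_entries :: "real ^ 'n \<Rightarrow> real list" where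
  "sorted_entries y = sorted_list_of_multiset (image_mset (\<lambda>i. y $ i) (mset_set UNIV))"

definition median :: "real ^ 'n \<Rightarrow> real" where
  "median y =
    (let xs = sorted_entries y; n = CARD('n)
     in if odd n then xs ! (n div 2) else (xs ! (n div 2 - 1) + xs ! (n div 2)) / 2)"

text \<open>
  \<open>y s t\<close> is the opinion vector on issue \<open>s\<close> at time \<open>t\<close>, \<open>\<theta> s\<close> the stubbornness vector during
  issue \<open>s\<close>, and \<open>lim (y s)\<close> is the final opinion \<open>y(s,\<infinity>)\<close>. Since \<open>lim\<close> is a total function,
  this predicate does not itself assert that the limits exist. Every choice of \<open>y 0 0\<close> and \<open>\<theta> 0\<close>
  extends to exactly one trajectory.
\<close>

definition concatenated_FJ_median ::
  "real ^ 'n ^ 'n \<Rightarrow> real \<Rightarrow> (nat \<Rightarrow> nat \<Rightarrow> real ^ 'n) \<Rightarrow> (nat \<Rightarrow> real ^ 'n) \<Rightarrow> bool" where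
  "concatenated_FJ_median W c y \<theta> \<longleftrightarrow>
     row_stochastic W \<and>
     (\<forall>s t. y s (Suc t) = ((mat 1 - diag (\<theta> s)) ** W) *v y s t + diag (\<theta> s) *v y s 0) \<and>
     (\<forall>s. y (Suc s) 0 = lim (y s)) \<and>
     (\<forall>s i. \<theta> (Suc s) $ i =
        \<theta> s $ i + c * (1 - \<theta> s $ i) * \<bar>lim (y s) $ i - median (lim (y s))\<bar>)"

lemma concatenated_FJ_median_exists:
  fixes W :: "real ^ 'n ^ 'n"
  assumes "row_stochastic W"
  shows "\<exists>y \<theta>. concatenated_FJ_median W c y \<theta> \<and> y 0 0 = y0 \<and> \<theta> 0 = \<theta>0"
proof -
  define traj :: "real ^ 'n \<Rightarrow> real ^ 'n \<Rightarrow> nat \<Rightarrow> real ^ 'n" where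
    "traj = (\<lambda>z v. rec_nat z (\<lambda>_ x. ((mat 1 - diag v) ** W) *v x + diag v *v z))"
  define nxt :: "real ^ 'n \<Rightarrow> real ^ 'n \<Rightarrow> real ^ 'n" where
    "nxt = (\<lambda>v x. \<chi> i. v $ i + c * (1 - v $ i) * \<bar>x $ i - median x\<bar>)"
  define st :: "nat \<Rightarrow> (real ^ 'n) \<times> (real ^ 'n)" where
    "st = rec_nat (y0, \<theta>0)
       (\<lambda>_ p. (lim (traj (fst p) (snd p)), nxt (snd p) (lim (traj (fst p) (snd p)))))"
  have "concatenated_FJ_median W c (\<lambda>s. traj (fst (st s)) (snd (st s))) (\<lambda>s. snd (st s))"
    using assms by (simp add: concatenated_FJ_median_def st_def traj_def nxt_def)
  moreover have "traj (fst (st 0)) (snd (st 0)) 0 = y0" "snd (st 0) = \<theta>0"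
    by (simp_all add: st_def traj_def)
  ultimately show ?thesis by blast
qed

end

(* On one issue each agent ends at a convex combination of its initial opinion (weight \<theta>_i) and a
   common value m, a weighted mean of the initial opinions. Hence the spread d(s) of the opinions
   shrinks by the factor q(s) = max_i \<theta>_i(s). Since the median lies in the range of the opinions,
   q(s+1) \<le> q(s) + c (1 - q(s)) d(s+1), and therefore
   c d(s+1) + q(s+1) \<le> q(s) + q(s) (2 - q(s)) c d(s) \<le> c d(s) + q(s).
   So q(s) stays below c d(0) + q(0) < 1, and the nested opinion ranges shrink geometrically. *)

theory Submission
  imports Defs
begin

lemma set_sorted_entries: "set (sorted_entries y) = range (($) y)"
  by (auto simp: sorted_entries_def)

lemma length_sorted_entries: "length (sorted_entries (y :: real ^ 'n)) = CARD('n)"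
proof -
  have "length (sorted_entries y) = size (mset (sorted_entries y))"
    by (simp only: size_mset)
  then show ?thesis
    by (simp add: sorted_entries_def)
qed

lemma median_in_interval:
  fixes y :: "real ^ 'n"
  assumes "\<And>i. y $ i \<in> {l..u}"
  shows "median y \<in> {l..u}"
proof -
  let ?xs = "sorted_entries y"
  have entry: "?xs ! k \<in> {l..u}" if "k < CARD('n)" for k
  proof -
    have "?xs ! k \<in> set ?xs"
      using that by (simp add: length_sorted_entries)
    then show ?thesis
      using assms by (auto simp: set_sorted_entries)
  qed
  \<comment> \<open>Both indices are below \<open>CARD('n)\<close>; for a single agent the truncated
    subtraction gives index 0.\<close>
  have "?xs ! (CARD('n) div 2) \<in> {l..u}" "?xs ! (CARD('n) div 2 - 1) \<in> {l..u}"
    using zero_less_card_finite[where 'a = 'n] by (intro entry; linarith)+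
  then show ?thesis
    by (auto simp: median_def Let_def)
qed

text \<open>Subtracting the fixed point \<open>p = b / (1 - r)\<close> leaves a geometric sequence
  with ratio \<open>r\<close>.\<close>

lemma affine_recurrence_tendsto:
  fixes a :: "nat \<Rightarrow> real"
  assumes "\<And>t. a (Suc t) = r * a t + b" and "\<bar>r\<bar> < 1"
  shows "a \<longlonglongrightarrow> b / (1 - r)"
proof -
  define p where "p = b / (1 - r)"
  have p: "p = r * p + b"
  proof -
    have "p * (1 - r) = b"
      using assms(2) by (auto simp: p_def)
    then show ?thesis
      by (simp add: algebra_simps)
  qed
  have "p + r ^ t * (a 0 - p) = a t" for t
  proof (induction t)
    case (Suc t)
    have "a (Suc t) = r * (p + r ^ t * (a 0 - p)) + b"
      by (simp only: assms(1) Suc.IH)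
    also have "\<dots> = (r * p + b) + r ^ Suc t * (a 0 - p)"
      by (simp add: algebra_simps)
    finally show ?case
      by (simp only: p[symmetric])
  qed simp
  moreover have "(\<lambda>t. p + r ^ t * (a 0 - p)) \<longlonglongrightarrow> p + 0 * (a 0 - p)"
    using assms(2) by (intro tendsto_intros LIMSEQ_power_zero) auto
  ultimately show ?thesis
    by (simp add: p_def)
qed

text \<open>Uniform weights replace every opinion by the average, so the agents are coupled through
  a single scalar.\<close>

lemma uniform_FJ_step_nth:
  fixes v x z :: "real ^ 'n"
  shows "(((mat 1 - diag v) ** (\<chi> i j. 1 / real CARD('n))) *v x + diag v *v z) $ i
    = (1 - v $ i) * ((\<Sum>j\<in>UNIV. x $ j) / real CARD('n)) + v $ i * z $ i"
proof -
  have "mat 1 - diag v = diag (1 - v)"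
    by (auto simp: vec_eq_iff mat_def diag_def)
  moreover have diag_mult: "(diag u *v w) $ i = u $ i * w $ i" for u w :: "real ^ 'n"
    by (simp add: diag_def matrix_vector_mult_def mult_delta_left)
  ultimately show ?thesis
    by (simp add: matrix_vector_mul_assoc[symmetric] diag_mult)
      (simp add: matrix_vector_mult_def sum_divide_distrib[symmetric])
qed

text \<open>Averaging the update gives an affine recurrence for the mean opinion \<open>a t\<close>
  with factor \<open>1 - V / n\<close>, where \<open>V\<close> is the total stubbornness. One
  positive stubbornness makes \<open>V > 0\<close>, hence the factor less than 1. The fixed point is
  the stubbornness-weighted mean \<open>m\<close>, and every coordinate follows
  \<open>a\<close>.\<close>

lemma uniform_FJ_tendsto:
  fixes v :: "real ^ 'n" and x :: "nat \<Rightarrow> real ^ 'n"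
  assumes step: "\<And>t. x (Suc t)
      = ((mat 1 - diag v) ** (\<chi> i j. 1 / real CARD('n))) *v x t + diag v *v x 0"
    and v: "\<And>i. 0 \<le> v $ i" "\<And>i. v $ i \<le> 1" "\<exists>i. 0 < v $ i"
  defines "m \<equiv> (\<Sum>i\<in>UNIV. v $ i * x 0 $ i) / (\<Sum>i\<in>UNIV. v $ i)"
  shows "x \<longlonglongrightarrow> (\<chi> i. (1 - v $ i) * m + v $ i * x 0 $ i)"
proof -
  define n where "n = real CARD('n)"
  define V where "V = (\<Sum>i\<in>UNIV. v $ i)"
  define a where "a t = (\<Sum>i\<in>UNIV. x t $ i) / n" for t
  have n: "n > 0"
    by (simp add: n_def)
  have V: "V > 0"
    unfolding V_def using v(1,3) sum_pos2[of UNIV _ "($) v"] by auto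
  have "V \<le> (\<Sum>i\<in>(UNIV :: 'n set). 1)"
    unfolding V_def by (intro sum_mono v)
  then have Vn: "V \<le> n"
    by (simp add: n_def)
  have nth: "x (Suc t) $ i = (1 - v $ i) * a t + v $ i * x 0 $ i" for t i
    unfolding step[of t] a_def n_def by (rule uniform_FJ_step_nth)
  have "a (Suc t) = (1 - V / n) * a t + (\<Sum>i\<in>UNIV. v $ i * x 0 $ i) / n" for t
  proof -
    have "(\<Sum>i\<in>UNIV. x (Suc t) $ i) = (n - V) * a t + (\<Sum>i\<in>UNIV. v $ i * x 0 $ i)"
      by (simp add: nth sum.distrib sum_distrib_right[symmetric] sum_subtractf V_def n_def)
    then show ?thesis
      using n by (simp add: a_def[of "Suc t"] add_divide_distrib diff_divide_distrib left_diff_distrib)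
  qed
  moreover have "\<bar>1 - V / n\<bar> < 1"
    using n V Vn by (simp add: abs_less_iff field_simps)
  ultimately have "a \<longlonglongrightarrow> ((\<Sum>i\<in>UNIV. v $ i * x 0 $ i) / n) / (1 - (1 - V / n))"
    by (rule affine_recurrence_tendsto)
  then have "a \<longlonglongrightarrow> m"
    using n by (simp add: m_def V_def)
  then have "(\<lambda>t. x (Suc t) $ i) \<longlonglongrightarrow> (1 - v $ i) * m + v $ i * x 0 $ i" for i
    unfolding nth by (intro tendsto_intros)
  then have "(\<lambda>t. x (Suc t)) \<longlonglongrightarrow> (\<chi> i. (1 - v $ i) * m + v $ i * x 0 $ i)"
    by (intro vec_tendstoI) simp
  then show ?thesis
    by (rule LIMSEQ_imp_Suc)
qed

lemma weighted_mean_in_interval: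
  fixes w f :: "'a \<Rightarrow> real"
  assumes "\<And>i. i \<in> A \<Longrightarrow> 0 \<le> w i" and "0 < sum w A" and "\<And>i. i \<in> A \<Longrightarrow> f i \<in> {l..u}"
  shows "(\<Sum>i\<in>A. w i * f i) / sum w A \<in> {l..u}"
proof -
  have "(\<Sum>i\<in>A. w i * l) \<le> (\<Sum>i\<in>A. w i * f i)" "(\<Sum>i\<in>A. w i * f i) \<le> (\<Sum>i\<in>A. w i * u)"
    using assms(1,3) by (intro sum_mono mult_left_mono; simp)+
  then have "sum w A * l \<le> (\<Sum>i\<in>A. w i * f i)" "(\<Sum>i\<in>A. w i * f i) \<le> sum w A * u"
    by (simp_all add: sum_distrib_right)
  then show ?thesis
    using assms(2) by (simp add: pos_le_divide_eq pos_divide_le_eq mult.commute)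
qed

text \<open>The interval for the limits is \<open>{l..u}\<close> contracted towards \<open>m\<close>
  by the factor \<open>q\<close>: it has length \<open>q * (u - l)\<close> and, as \<open>m\<close>
  lies in \<open>{l..u}\<close>, it stays inside \<open>{l..u}\<close>.\<close>

lemma uniform_FJ_limit:
  fixes v :: "real ^ 'n" and x :: "nat \<Rightarrow> real ^ 'n"
  assumes step: "\<And>t. x (Suc t)
      = ((mat 1 - diag v) ** (\<chi> i j. 1 / real CARD('n))) *v x t + diag v *v x 0"
    and v: "\<And>i. 0 \<le> v $ i" "\<And>i. v $ i \<le> q" "\<exists>i. 0 < v $ i" and q: "q \<le> 1"
    and x0: "\<And>i. x 0 $ i \<in> {l..u}"
  obtains m where "convergent x" "m \<in> {l..u}"
    "\<And>i. lim x $ i \<in> {(1 - q) * m + q * l..(1 - q) * m + q * u}"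
proof -
  define m where "m = (\<Sum>i\<in>UNIV. v $ i * x 0 $ i) / (\<Sum>i\<in>UNIV. v $ i)"
  have "0 < (\<Sum>i\<in>UNIV. v $ i)"
    using v(1,3) sum_pos2[of UNIV _ "($) v"] by auto
  then have m: "m \<in> {l..u}"
    unfolding m_def using v(1) x0 by (intro weighted_mean_in_interval) auto
  have lim: "x \<longlonglongrightarrow> (\<chi> i. (1 - v $ i) * m + v $ i * x 0 $ i)"
    unfolding m_def using step v(1) order_trans[OF v(2) q] v(3)
    by (rule uniform_FJ_tendsto)
  have "lim x $ i \<in> {(1 - q) * m + q * l..(1 - q) * m + q * u}" for i
  proof -
    have eq: "lim x $ i = m + v $ i * (x 0 $ i - m)"
      using limI[OF lim] by (simp add: algebra_simps)
    \<comment> \<open>First the initial opinion is moved to an endpoint, then \<open>v $ i\<close>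
      is raised to \<open>q\<close>; the latter uses \<open>l \<le> m \<le> u\<close>.\<close>
    have "v $ i * (x 0 $ i - m) \<le> v $ i * (u - m)" "v $ i * (m - x 0 $ i) \<le> v $ i * (m - l)"
      using v(1)[of i] x0[of i] by (auto intro!: mult_left_mono)
    moreover have "v $ i * (u - m) \<le> q * (u - m)" "v $ i * (m - l) \<le> q * (m - l)"
      using v(2)[of i] m by (auto intro!: mult_right_mono)
    ultimately show ?thesis
      unfolding eq by (simp add: algebra_simps)
  qed
  with lim m show ?thesis
    using that convergentI by blast
qed

text \<open>The potential \<open>c * d + q\<close> cannot grow because
  \<open>q * (2 - q) = 1 - (1 - q)\<^sup>2\<close> is at most 1.\<close>

lemma stubbornness_potential_step:
  fixes c d d' q q' :: real
  assumes "0 \<le> c" "0 \<le> d" "q \<ge> 0" "q \<le> 1" "d' \<le> q * d" "q' \<le> q + c * (1 - q) * d'"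
  shows "c * d' + q' \<le> c * d + q"
proof -
  have "c * d' + q' \<le> q + (2 - q) * (c * d')"
    using assms(6) by (simp add: algebra_simps)
  also have "\<dots> \<le> q + (2 - q) * (c * (q * d))"
    using assms by (intro add_left_mono mult_left_mono) auto
  also have "\<dots> = c * d + q - (1 - q)\<^sup>2 * (c * d)"
    by (simp add: algebra_simps power2_eq_square)
  also have "\<dots> \<le> c * d + q"
    using assms by simp
  finally show ?thesis .
qed

theorem mainTheorem3:
  fixes y :: "nat \<Rightarrow> nat \<Rightarrow> real ^ 'n" and \<theta> :: "nat \<Rightarrow> real ^ 'n" and c :: real
  assumes "CARD('n) \<ge> 2"
    and "0 \<le> c" and "c \<le> 1"
    and "concatenated_FJ_median (\<chi> i j. 1 / real CARD('n)) c y \<theta>"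
    and "\<forall>i. 0 \<le> y 0 0 $ i \<and> y 0 0 $ i \<le> 1"
    and "\<forall>i. 0 \<le> \<theta> 0 $ i \<and> \<theta> 0 $ i < 1"
    and "\<exists>i. \<theta> 0 $ i > 0"
    and "c * Max {\<bar>y 0 0 $ i - y 0 0 $ j\<bar> | i j. True} + Max {\<theta> 0 $ i | i. True} < 1"
  shows "(\<forall>s. convergent (y s)) \<and>
    (\<exists>L \<in> span {1 :: real ^ 'n}. (\<lambda>s. lim (y s)) \<longlonglongrightarrow> L)"
proof -
  \<comment> \<open>The spread is split into its two endpoints, which are monotone in
    \<open>s\<close>. The initial potential \<open>r\<close> bounds every \<open>q s\<close> and so
    serves as a uniform contraction rate.\<close>
  define U where "U s = Max (range (($) (y s 0)))" for s
  define L where "L s = Min (range (($) (y s 0)))" for s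
  define q where "q s = Max (range (($) (\<theta> s)))" for s
  define r where "r = c * (U 0 - L 0) + q 0"
  have step: "y s (Suc t)
      = ((mat 1 - diag (\<theta> s)) ** (\<chi> i j. 1 / real CARD('n))) *v y s t + diag (\<theta> s) *v y s 0"
    and nxt: "y (Suc s) 0 = lim (y s)"
    and upd: "\<theta> (Suc s) $ i
      = \<theta> s $ i + c * (1 - \<theta> s $ i) * \<bar>lim (y s) $ i - median (lim (y s))\<bar>" for s t i
    using assms(4) unfolding concatenated_FJ_median_def by auto
  have yb: "y s 0 $ i \<in> {L s..U s}" for s i
    by (simp add: L_def U_def)
  have qb: "\<theta> s $ i \<le> q s" for s i
    by (simp add: q_def)
  have LU: "L s \<le> U s" for s
    using yb[of s] by (meson atLeastAtMost_iff order_trans)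
  have U_le: "U s \<le> b" if "\<And>i. y s 0 $ i \<le> b" for s b
    using that by (simp add: U_def)
  have L_ge: "b \<le> L s" if "\<And>i. b \<le> y s 0 $ i" for s b
    using that by (simp add: L_def)
  have q_le: "q s \<le> b" if "\<And>i. \<theta> s $ i \<le> b" for s b
    using that by (simp add: q_def)
  have r1: "r < 1"
  proof -
    have fin: "finite {\<bar>y 0 0 $ i - y 0 0 $ j\<bar> | i j. True}"
      using finite_image_set2[of "\<lambda>_. True" "\<lambda>_. True" "\<lambda>i j. \<bar>y 0 0 $ i - y 0 0 $ j\<bar>"]
      by simp
    have "U 0 \<in> range (($) (y 0 0))" "L 0 \<in> range (($) (y 0 0))"
      unfolding U_def L_def by (intro Max_in Min_in; simp)+
    then obtain i j where "U 0 = y 0 0 $ i" "L 0 = y 0 0 $ j"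
      by blast
    then have "U 0 - L 0 \<le> \<bar>y 0 0 $ i - y 0 0 $ j\<bar>"
      by simp
    also have "\<dots> \<le> Max {\<bar>y 0 0 $ i - y 0 0 $ j\<bar> | i j. True}"
      using fin by (intro Max_ge) auto
    finally have "c * (U 0 - L 0) \<le> c * Max {\<bar>y 0 0 $ i - y 0 0 $ j\<bar> | i j. True}"
      using assms(2) by (rule mult_left_mono)
    moreover have "q 0 = Max {\<theta> 0 $ i | i. True}"
      by (simp add: q_def full_SetCompr_eq)
    ultimately show ?thesis
      using assms(8) by (simp add: r_def)
  qed
  \<comment> \<open>The invariant carried across issues: the sign conditions give convergence within
    an issue, the potential bound keeps \<open>q s\<close> below 1.\<close>
  define good where "good s \<longleftrightarrow> (\<forall>i. 0 \<le> \<theta> s $ i) \<and> (\<exists>i. 0 < \<theta> s $ i)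
    \<and> c * (U s - L s) + q s \<le> r" for s
  have issue: "good (Suc s) \<and> convergent (y s) \<and> L s \<le> L (Suc s) \<and> U (Suc s) \<le> U s
      \<and> U (Suc s) - L (Suc s) \<le> r * (U s - L s)" if good: "good s" for s
  proof -
    have qr: "q s \<le> r"
      using good assms(2) LU[of s] unfolding good_def by (smt (verit) mult_nonneg_nonneg)
    have \<theta>: "0 \<le> \<theta> s $ i" "\<theta> s $ i \<le> q s" for i
      using good qb by (auto simp: good_def)
    then have q0: "0 \<le> q s"
      by (rule order_trans)
    have q1: "q s < 1"
      using qr r1 by simp
    obtain m where conv: "convergent (y s)" and m: "m \<in> {L s..U s}"
      and lim: "\<And>i. lim (y s) $ i \<in> {(1 - q s) * m + q s * L s..(1 - q s) * m + q s * U s}"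
      using uniform_FJ_limit[of "y s" "\<theta> s" "q s" "L s" "U s"] step \<theta> good q1 yb
      unfolding good_def by (metis less_imp_le)
    have U': "U (Suc s) \<le> (1 - q s) * m + q s * U s"
      and L': "(1 - q s) * m + q s * L s \<le> L (Suc s)"
      using lim by (auto intro!: U_le L_ge simp: nxt)
    have shrink: "U (Suc s) - L (Suc s) \<le> q s * (U s - L s)"
      using U' L' by (simp add: algebra_simps)
    have "(1 - q s) * m \<le> (1 - q s) * U s" "(1 - q s) * L s \<le> (1 - q s) * m"
      using m q1 by (auto intro!: mult_left_mono)
    then have nested: "L s \<le> L (Suc s)" "U (Suc s) \<le> U s"
      using U' L' by (simp_all add: algebra_simps)
    define D where "D = U (Suc s) - L (Suc s)"
    \<comment> \<open>This makes \<open>\<theta> + c * (1 - \<theta>) * D\<close> nondecreasing in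
      \<open>\<theta>\<close>, so that it can be bounded by its value at \<open>q s\<close>.\<close>
    have cD: "c * D \<le> 1"
    proof -
      have "c * D \<le> c * (U s - L s)"
        using nested assms(2) by (intro mult_left_mono) (auto simp: D_def)
      also have "\<dots> \<le> 1"
        using good q0 r1 by (auto simp: good_def)
      finally show ?thesis .
    qed
    \<comment> \<open>An opinion and the median both lie in the next range, whose length is
      \<open>D\<close>.\<close>
    have dev: "\<bar>lim (y s) $ i - median (lim (y s))\<bar> \<le> D" for i
      using yb[of "Suc s" i] median_in_interval[of "y (Suc s) 0", OF yb] by (auto simp: nxt D_def)
    \<comment> \<open>Stubbornness never decreases, so a positive entry stays positive.\<close>
    have "\<theta> s $ i \<le> \<theta> (Suc s) $ i" for i
      using \<theta>[of i] q1 assms(2) by (simp add: upd)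
    then have pos: "(\<forall>i. 0 \<le> \<theta> (Suc s) $ i) \<and> (\<exists>i. 0 < \<theta> (Suc s) $ i)"
      using good unfolding good_def by (meson less_le_trans order_trans)
    have "\<theta> (Suc s) $ i \<le> q s + c * (1 - q s) * D" for i
    proof -
      have "\<theta> (Suc s) $ i \<le> \<theta> s $ i + c * (1 - \<theta> s $ i) * D"
        using \<theta>[of i] q1 assms(2) dev[of i] by (simp add: upd mult_left_mono)
      also have "\<dots> = c * D + (1 - c * D) * \<theta> s $ i"
        by (simp add: algebra_simps)
      also have "\<dots> \<le> c * D + (1 - c * D) * q s"
        using \<theta>(2)[of i] cD by (intro add_left_mono mult_left_mono) auto
      finally show ?thesis
        by (simp add: algebra_simps)
    qed
    then have "q (Suc s) \<le> q s + c * (1 - q s) * D"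
      by (rule q_le)
    then have "c * D + q (Suc s) \<le> c * (U s - L s) + q s"
      using assms(2) LU[of s] q0 q1 shrink
      by (intro stubbornness_potential_step) (auto simp: D_def)
    then have "good (Suc s)"
      using pos good by (auto simp: good_def D_def)
    moreover have "q s * (U s - L s) \<le> r * (U s - L s)"
      using qr LU[of s] by (intro mult_right_mono) auto
    ultimately show ?thesis
      using conv nested shrink by auto
  qed
  have good: "good s" for s
  proof (induction s)
    case 0
    then show ?case
      using assms(6,7) by (auto simp: good_def r_def)
  qed (use issue in blast)
  note issue = issue[OF good]
  have r0: "0 \<le> r"
  proof -
    have "0 \<le> q 0"
      using assms(6) qb[of 0] by (meson order_trans)
    then show ?thesis
      using assms(2) LU[of 0] by (simp add: r_def)
  qed
  have decay: "U s - L s \<le> r ^ s * (U 0 - L 0)" for s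
  proof (induction s)
    case (Suc s)
    have "U (Suc s) - L (Suc s) \<le> r * (U s - L s)"
      using issue by blast
    also have "\<dots> \<le> r * (r ^ s * (U 0 - L 0))"
      using Suc r0 by (rule mult_left_mono)
    finally show ?case
      by simp
  qed simp
  have "(\<lambda>s. r ^ s * (U 0 - L 0)) \<longlonglongrightarrow> 0"
    using r0 r1 by (intro tendsto_mult_left_zero LIMSEQ_power_zero) auto
  then have gap: "(\<lambda>s. U s - L s) \<longlonglongrightarrow> 0"
    by (rule tendsto_sandwich[OF _ _ tendsto_const, rotated 2])
      (simp_all only: LU decay diff_ge_0_iff_ge always_eventually simp_thms)
  \<comment> \<open>Nestedness bounds the decreasing sequence \<open>U\<close> below by
    \<open>L 0\<close>; since the gap vanishes, \<open>L\<close> has the same limit and squeezes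
    every opinion.\<close>
  have "L 0 \<le> L s" for s
    using lift_Suc_mono_le[of L 0 s] issue by blast
  then have "L 0 \<le> U s" for s
    using LU by (rule order_trans)
  moreover have "decseq U"
    using issue by (intro decseq_SucI) blast
  ultimately obtain l where U: "U \<longlonglongrightarrow> l"
    using decseq_convergent by blast
  then have L: "L \<longlonglongrightarrow> l"
    using tendsto_diff[OF U gap] by simp
  have "(\<lambda>s. y s 0) \<longlonglongrightarrow> l *\<^sub>R 1"
  proof (rule vec_tendstoI)
    fix i
    show "(\<lambda>s. y s 0 $ i) \<longlonglongrightarrow> (l *\<^sub>R 1 :: real ^ 'n) $ i"
      using tendsto_sandwich[OF _ _ L U, of "\<lambda>s. y s 0 $ i"] yb by simp
  qed
  \<comment> \<open>The final opinions are the initial opinions of the next issue, hence a shifted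
    sequence.\<close>
  then have "(\<lambda>s. lim (y s)) \<longlonglongrightarrow> l *\<^sub>R 1"
    unfolding nxt[symmetric] by (rule LIMSEQ_Suc)
  moreover have "l *\<^sub>R 1 \<in> span {1 :: real ^ 'n}"
    by (simp add: span_base span_scale)
  ultimately show ?thesis
    using issue by blast
qed

end
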